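(* Let $X \subset A^{\mathbb{Z}}$ be a one-dimensional subshift of finite type (i.e. a subshift of finite type over the group $\mathbb{Z}$). Then $X$ is topologically mixing if and only if $X$ is contractible.
   Context: For a finite set $A$ (alphabet) and a group $G$, $A^G$ carries the product topology (discrete $A$) and the shift action $(gx)_h = x_{g^{-1}h}$. A subshift is a topologically closed, shift-invariant subset $X \subset A^G$. A finite pattern is an element $p \in A^D$ with $D \subset G$ finite; it appears in $x \in A^G$ if for some $g \in G$ one has $x_{gd} = p_d$ for all $d \in D$. $X$ is a subshift of finite type (SFT) if there is a finite set of finite patterns such that $X$ is the set of all $x \in A^G$ in which none of them appears. A block map (morphism) between $G$-subshifts is a continuous shift-commuting map. Products of subshifts carry the diagonal action. Let $I = \{0,1\}^G$, and let $\bar 0, \bar 1 \in I$ be the constant configurations. A subshift $X$ is contractible if there is a block map $h : I \times X \times X \to X$ with $h(\bar 0, x, y) = x$ and $h(\bar 1, x, y) = y$ for all $x, y \in X$. $X \subset A^{\mathbb{Z}}$ is topologically mixing if for all finite $E, F \subset \mathbb{Z}$ there exists $R$ such that whenever $x, y \in X$ and $a \in \mathbb{Z}$ satisfies $|e - (a+f)| \geq R$ for all $e \in E, f \in F$, there exists $z \in X$ with $z|_E = x|_E$ and $z|_{a+F} = y|_{a+F}$. *)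

theory Defs
  imports "HOL-Analysis.Analysis"
begin

(* Groups are written additively but need not be commutative (class group_add). *)

definition full_shift :: "'a set \<Rightarrow> ('g \<Rightarrow> 'a) topology" where
  "full_shift A = product_topology (\<lambda>_. discrete_topology A) UNIV"

definition shift :: "'g::group_add \<Rightarrow> ('g \<Rightarrow> 'a) \<Rightarrow> ('g \<Rightarrow> 'a)" where
  "shift g x = (\<lambda>h. x (- g + h))"

definition subshift :: "'a set \<Rightarrow> ('g::group_add \<Rightarrow> 'a) set \<Rightarrow> bool" where
  "subshift A X \<longleftrightarrow> closedin (full_shift A) X \<and> (\<forall>g. \<forall>x\<in>X. shift g x \<in> X)"

(* A pattern p in A^D is a partial map with domain D. *)
definition finite_pattern :: "'a set \<Rightarrow> ('g \<rightharpoonup> 'a) \<Rightarrow> bool" where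
  "finite_pattern A p \<longleftrightarrow> finite (dom p) \<and> ran p \<subseteq> A"

definition appears_in :: "('g::group_add \<rightharpoonup> 'a) \<Rightarrow> ('g \<Rightarrow> 'a) \<Rightarrow> bool" where
  "appears_in p x \<longleftrightarrow> (\<exists>g. \<forall>d\<in>dom p. p d = Some (x (g + d)))"

definition sft :: "'a set \<Rightarrow> ('g::group_add \<Rightarrow> 'a) set \<Rightarrow> bool" where
  "sft A X \<longleftrightarrow> subshift A X \<and>
     (\<exists>P. finite P \<and> (\<forall>p\<in>P. finite_pattern A p) \<and>
          X = {x \<in> topspace (full_shift A). \<forall>p\<in>P. \<not> appears_in p x})"

(* Stated for arbitrary topological spaces with an action, so that it applies
   directly to products of subshifts with the diagonal action. *)
definition block_map ::
  "'x topology \<Rightarrow> ('g \<Rightarrow> 'x \<Rightarrow> 'x) \<Rightarrow> 'y topology \<Rightarrow> ('g \<Rightarrow> 'y \<Rightarrow> 'y) \<Rightarrow> ('x \<Rightarrow> 'y) \<Rightarrow> bool"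
where
  "block_map S \<alpha> T \<beta> f \<longleftrightarrow>
     continuous_map S T f \<and> (\<forall>g. \<forall>x\<in>topspace S. f (\<alpha> g x) = \<beta> g (f x))"

definition subshift_topology :: "'a set \<Rightarrow> ('g \<Rightarrow> 'a) set \<Rightarrow> ('g \<Rightarrow> 'a) topology" where
  "subshift_topology A X = subtopology (full_shift A) X"

definition contractible_subshift :: "'a set \<Rightarrow> ('g::group_add \<Rightarrow> 'a) set \<Rightarrow> bool" where
  "contractible_subshift A X \<longleftrightarrow>
     (\<exists>h :: ('g \<Rightarrow> nat) \<times> ('g \<Rightarrow> 'a) \<times> ('g \<Rightarrow> 'a) \<Rightarrow> ('g \<Rightarrow> 'a).
        block_map
          (prod_topology (full_shift {0, 1})
             (prod_topology (subshift_topology A X) (subshift_topology A X)))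
          (\<lambda>g. map_prod (shift g) (map_prod (shift g) (shift g)))
          (subshift_topology A X) shift h \<and>
        (\<forall>x\<in>X. \<forall>y\<in>X. h (\<lambda>_. 0, x, y) = x \<and> h (\<lambda>_. 1, x, y) = y))"

definition topologically_mixing :: "(int \<Rightarrow> 'a) set \<Rightarrow> bool" where
  "topologically_mixing X \<longleftrightarrow>
     (\<forall>E F. finite E \<and> finite F \<longrightarrow>
        (\<exists>R::int. \<forall>x\<in>X. \<forall>y\<in>X. \<forall>a.
           (\<forall>e\<in>E. \<forall>f\<in>F. \<bar>e - (a + f)\<bar> \<ge> R) \<longrightarrow>
           (\<exists>z\<in>X. (\<forall>e\<in>E. z e = x e) \<and> (\<forall>f\<in>F. z (a + f) = y (a + f)))))"

end

theory Submission
  imports Defs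
begin

text \<open>
  By compactness a contraction h is a local rule, so if the selector i is 0 around E and 1 around
  a + F, then h(i, x, y) agrees with x on E and with y on a + F.
  Conversely, first modify i by a local rule so that it is constant on intervals of length L after
  each of its changes; then copy x where it is 0 and y where it is 1. After each
  change, m positions are filled by a connecting word, which mixing provides for every pair of
  adjacent words of length n. For L = m + n each window of the result that is short enough to be
  tested by a forbidden pattern sees at most one connecting word, hence is a window of a point of X.
\<close>

section \<open>Continuity as locality\<close>

lemma topspace_full_shift: "topspace (full_shift A) = {x. \<forall>k. x k \<in> A}"
  by (auto simp: full_shift_def PiE_def Pi_def)

lemma compact_full_shift: "finite A \<Longrightarrow> compact_space (full_shift A)"
  by (simp add: full_shift_def compact_space_product_topology compact_space_discrete_topology)

lemma continuous_map_full_shift_eval: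
  "continuous_map (full_shift A) (discrete_topology A) (\<lambda>x. x k)"
  unfolding full_shift_def by (rule continuous_map_product_projection) simp

lemma openin_full_shift_cylinder:
  assumes "openin (full_shift A) U" "x \<in> U"
  shows "\<exists>K. finite K \<and> (\<forall>y\<in>topspace (full_shift A). (\<forall>k\<in>K. y k = x k) \<longrightarrow> y \<in> U)"
proof -
  obtain V where V: "finite {k. V k \<noteq> A}" "x \<in> Pi\<^sub>E UNIV V" "Pi\<^sub>E UNIV V \<subseteq> U"
    using assms unfolding full_shift_def openin_product_topology_alt by fastforce
  have "y \<in> U" if "y \<in> topspace (full_shift A)" "\<forall>k\<in>{k. V k \<noteq> A}. y k = x k" for y
  proof -
    have "y k \<in> V k" for k
      using that V(2) by (cases "V k = A") (auto simp: topspace_full_shift PiE_def Pi_def)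
    then show ?thesis using V(3) by (auto simp: PiE_def)
  qed
  then show ?thesis using V(1) by blast
qed

section \<open>Cylinders in the domain of a contraction\<close>

abbreviation homotopy_domain ::
  "'b set \<Rightarrow> 'a set \<Rightarrow> ('g \<Rightarrow> 'a) set \<Rightarrow> (('g \<Rightarrow> 'b) \<times> ('g \<Rightarrow> 'a) \<times> ('g \<Rightarrow> 'a)) topology" where
  "homotopy_domain B A X \<equiv> prod_topology (full_shift B)
     (prod_topology (subshift_topology A X) (subshift_topology A X))"

text \<open>For finite \<open>K\<close>, the \<open>q\<close> that agree with \<open>p\<close> on
  \<open>K\<close> form a cylinder around \<open>p\<close>. These cylinders let locality be
  expressed for all three arguments of a contraction at once.\<close>

definition agree_on ::
  "'g set \<Rightarrow> ('g \<Rightarrow> 'b) \<times> ('g \<Rightarrow> 'a) \<times> ('g \<Rightarrow> 'a) \<Rightarrow> ('g \<Rightarrow> 'b) \<times> ('g \<Rightarrow> 'a) \<times> ('g \<Rightarrow> 'a) \<Rightarrow> bool"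
where
  "agree_on K p q \<longleftrightarrow> (\<forall>k\<in>K. fst p k = fst q k \<and> fst (snd p) k = fst (snd q) k
     \<and> snd (snd p) k = snd (snd q) k)"

lemma topspace_subshift_topology: "X \<subseteq> topspace (full_shift A) \<Longrightarrow> topspace (subshift_topology A X) = X"
  by (auto simp: subshift_topology_def)

lemma openin_subshift_cylinder:
  assumes "openin (subshift_topology A X) U" "x \<in> U"
  shows "\<exists>K. finite K \<and> (\<forall>y\<in>topspace (subshift_topology A X). (\<forall>k\<in>K. y k = x k) \<longrightarrow> y \<in> U)"
proof -
  obtain T where T: "openin (full_shift A) T" "U = T \<inter> X"
    using assms(1) by (auto simp: subshift_topology_def openin_subtopology)
  with assms(2) openin_full_shift_cylinder[OF T(1)] obtain K where
    "finite K" "\<forall>y\<in>topspace (full_shift A). (\<forall>k\<in>K. y k = x k) \<longrightarrow> y \<in> T" by blast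
  then show ?thesis using T(2) by (intro exI[of _ K]) (auto simp: subshift_topology_def)
qed

lemma openin_homotopy_domain_cylinder:
  assumes "openin (homotopy_domain B A X) U" "p \<in> U"
  shows "\<exists>K. finite K \<and> (\<forall>q\<in>topspace (homotopy_domain B A X). agree_on K q p \<longrightarrow> q \<in> U)"
proof -
  obtain i x y where p: "p = (i, x, y)" by (metis prod.exhaust)
  note alt = openin_prod_topology_alt[THEN iffD1, THEN spec, THEN spec, THEN mp]
  have "(i, x, y) \<in> U" using assms(2) by (simp only: p)
  from alt[OF assms(1) this] obtain U1 U' where U':
    "openin (full_shift B) U1"
    "openin (prod_topology (subshift_topology A X) (subshift_topology A X)) U'"
    "i \<in> U1" "(x, y) \<in> U'" "U1 \<times> U' \<subseteq> U"
    by (elim exE conjE)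
  from alt[OF U'(2,4)] obtain U2 U3 where U:
    "openin (subshift_topology A X) U2" "openin (subshift_topology A X) U3"
    "x \<in> U2" "y \<in> U3" "U2 \<times> U3 \<subseteq> U'"
    by (elim exE conjE)
  obtain K1 K2 K3 where K: "finite K1" "finite K2" "finite K3"
    and K1: "\<forall>z\<in>topspace (full_shift B). (\<forall>k\<in>K1. z k = i k) \<longrightarrow> z \<in> U1"
    and K2: "\<forall>z\<in>topspace (subshift_topology A X). (\<forall>k\<in>K2. z k = x k) \<longrightarrow> z \<in> U2"
    and K3: "\<forall>z\<in>topspace (subshift_topology A X). (\<forall>k\<in>K3. z k = y k) \<longrightarrow> z \<in> U3"
    using openin_full_shift_cylinder[OF U'(1,3)] openin_subshift_cylinder[OF U(1,3)]
      openin_subshift_cylinder[OF U(2,4)] by (elim exE conjE)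
  have "q \<in> U" if "q \<in> topspace (homotopy_domain B A X)" "agree_on (K1 \<union> K2 \<union> K3) q p" for q
  proof -
    obtain a b c where q: "q = (a, b, c)" by (metis prod.exhaust)
    have "a \<in> U1" "b \<in> U2" "c \<in> U3"
      using that K1 K2 K3 by (auto simp: q p agree_on_def)
    then show ?thesis using U(5) U'(5) by (auto simp: q)
  qed
  then show ?thesis using K by (intro exI[of _ "K1 \<union> K2 \<union> K3"]) auto
qed

text \<open>Values \<open>c\<close> outside \<open>C\<close> are covered too, with an empty fibre,
  because \<open>openin_agree_on\<close> takes the coordinates of an arbitrary
  \<open>p\<close>.\<close>

lemma openin_fibre_discrete:
  assumes "continuous_map S (discrete_topology C) f"
  shows "openin S {q \<in> topspace S. f q = c}"
proof (cases "c \<in> C")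
  case True
  then show ?thesis
    using openin_continuous_map_preimage[OF assms, of "{c}"] by simp
next
  case False
  then have "{q \<in> topspace S. f q = c} = {}"
    using assms unfolding continuous_map_def by fastforce
  then show ?thesis by (simp only: openin_empty)
qed

lemma openin_agree_on:
  assumes "finite K"
  shows "openin (homotopy_domain B A X)
    {q \<in> topspace (homotopy_domain B A X). agree_on K q p}" (is "openin ?S _")
proof -
  let ?T = "subshift_topology A X"
  have sub: "continuous_map ?T (discrete_topology A) (\<lambda>x. x k)" for k
    unfolding subshift_topology_def
    by (intro continuous_map_from_subtopology continuous_map_full_shift_eval)
  have 1: "continuous_map ?S (discrete_topology B) (\<lambda>q. fst q k)" for k
    using continuous_map_compose[OF continuous_map_fst continuous_map_full_shift_eval]
    by (simp add: o_def)
  have 2: "continuous_map ?S (discrete_topology A) (\<lambda>q. fst (snd q) k)" for k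
    using continuous_map_compose[OF continuous_map_compose[OF continuous_map_snd continuous_map_fst] sub]
    by (simp add: o_def)
  have 3: "continuous_map ?S (discrete_topology A) (\<lambda>q. snd (snd q) k)" for k
    using continuous_map_compose[OF continuous_map_compose[OF continuous_map_snd continuous_map_snd] sub]
    by (simp add: o_def)
  show ?thesis
    using assms
  proof induction
    case empty
    then show ?case by (simp add: agree_on_def del: topspace_prod_topology)
  next
    case (insert k K)
    have "{q \<in> topspace ?S. agree_on (insert k K) q p} =
      {q \<in> topspace ?S. fst q k = fst p k} \<inter>
      ({q \<in> topspace ?S. fst (snd q) k = fst (snd p) k} \<inter>
      ({q \<in> topspace ?S. snd (snd q) k = snd (snd p) k} \<inter>
       {q \<in> topspace ?S. agree_on K q p}))"
      by (auto simp: agree_on_def)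
    then show ?case
      by (simp only: openin_Int insert.IH openin_fibre_discrete[OF 1]
          openin_fibre_discrete[OF 2] openin_fibre_discrete[OF 3])
  qed
qed

text \<open>The cylinder over \<open>K\<close> around a point stays inside any preimage containing
  that point, so every preimage is open. This gives the continuity of the glued map later
  on.\<close>

lemma continuous_map_discrete_if_local:
  assumes "f \<in> topspace (homotopy_domain B A X) \<rightarrow> C" "finite K"
    and loc: "\<And>p q. p \<in> topspace (homotopy_domain B A X) \<Longrightarrow>
      q \<in> topspace (homotopy_domain B A X) \<Longrightarrow> agree_on K q p \<Longrightarrow> f q = f p"
  shows "continuous_map (homotopy_domain B A X) (discrete_topology C) f"
    (is "continuous_map ?S _ _")
proof -
  have "openin ?S {p \<in> topspace ?S. f p \<in> U}" for U
  proof (subst openin_subopen, intro ballI)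
    fix p assume p: "p \<in> {p \<in> topspace ?S. f p \<in> U}"
    show "\<exists>T. openin ?S T \<and> p \<in> T \<and> T \<subseteq> {p \<in> topspace ?S. f p \<in> U}"
    proof (intro exI conjI)
      show "openin ?S {q \<in> topspace ?S. agree_on K q p}"
        by (rule openin_agree_on[OF assms(2)])
      show "p \<in> {q \<in> topspace ?S. agree_on K q p}"
        using p by (simp add: agree_on_def)
      show "{q \<in> topspace ?S. agree_on K q p} \<subseteq> {p \<in> topspace ?S. f p \<in> U}"
        using p loc by (smt (verit, best) mem_Collect_eq subsetI)
    qed
  qed
  then show ?thesis using assms(1) by (auto simp: continuous_map_def)
qed

text \<open>This is the compactness half of the Curtis-Hedlund-Lyndon theorem. Continuity makes
  \<open>f\<close> constant on a cylinder around each point; finitely many of these cover the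
  domain, and the union of their windows serves for all points.\<close>

lemma local_if_continuous_map_discrete:
  assumes "finite A" "finite B" "closedin (full_shift A) X"
    and cont: "continuous_map (homotopy_domain B A X) (discrete_topology C) f"
  obtains K where "finite K" "\<And>p q. p \<in> topspace (homotopy_domain B A X) \<Longrightarrow>
      q \<in> topspace (homotopy_domain B A X) \<Longrightarrow> agree_on K q p \<Longrightarrow> f q = f p"
proof -
  let ?S = "homotopy_domain B A X"
  have "compact_space (subshift_topology A X)"
    unfolding subshift_topology_def using assms
    by (intro compact_space_subtopology closedin_compact_space compact_full_shift)
  then have compact: "compact_space ?S"
    by (simp add: compact_space_prod_topology compact_full_shift assms(2))
  have "\<exists>K. finite K \<and> (\<forall>q\<in>topspace ?S. agree_on K q p \<longrightarrow> f q = f p)"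
    if p: "p \<in> topspace ?S" for p
  proof -
    have "f p \<in> C" using cont p by (auto simp: continuous_map_def)
    then have "openin ?S {q \<in> topspace ?S. f q \<in> {f p}}"
      by (intro openin_continuous_map_preimage[OF cont]) simp
    from openin_homotopy_domain_cylinder[OF this, of p] p show ?thesis by auto
  qed
  then obtain K where K: "\<And>p. p \<in> topspace ?S \<Longrightarrow> finite (K p)"
    "\<And>p q. p \<in> topspace ?S \<Longrightarrow> q \<in> topspace ?S \<Longrightarrow> agree_on (K p) q p \<Longrightarrow> f q = f p"
    by metis
  define cyl where "cyl p = {q \<in> topspace ?S. agree_on (K p) q p}" for p
  have "\<exists>\<F>. finite \<F> \<and> \<F> \<subseteq> cyl ` topspace ?S \<and> topspace ?S \<subseteq> \<Union>\<F>"
  proof (rule compact[unfolded compact_space_alt, rule_format], intro conjI ballI)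
    fix U assume "U \<in> cyl ` topspace ?S"
    then obtain p where "p \<in> topspace ?S" "U = cyl p" by blast
    then show "openin ?S U" using openin_agree_on[OF K(1)] by (simp only: cyl_def)
  next
    show "topspace ?S \<subseteq> \<Union> (cyl ` topspace ?S)"
      unfolding cyl_def agree_on_def by blast
  qed
  then obtain Q where Q: "finite Q" "Q \<subseteq> topspace ?S" "topspace ?S \<subseteq> \<Union> (cyl ` Q)"
    by (metis finite_subset_image)
  show thesis
  proof
    show "finite (\<Union> (K ` Q))" using Q K(1) by blast
    fix p q assume pq: "p \<in> topspace ?S" "q \<in> topspace ?S" "agree_on (\<Union> (K ` Q)) q p"
    \<comment> \<open>The window of \<open>r\<close> is part of the union, so \<open>q\<close> lies
      in the same cylinder around \<open>r\<close> as \<open>p\<close>.\<close>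
    obtain r where r: "r \<in> Q" "p \<in> cyl r" using Q(3) pq(1) by blast
    then have "agree_on (K r) p r" "agree_on (K r) q r"
      using pq(3) by (auto simp: cyl_def agree_on_def)
    moreover have "r \<in> topspace ?S" using r(1) Q(2) by (rule rev_subsetD)
    ultimately show "f q = f p" using K(2)[of r p] K(2)[of r q] pq(1,2) by simp
  qed
qed

section \<open>Contractible subshifts are mixing\<close>

lemma shift_int: "shift g x = (\<lambda>h::int. x (h - g))"
  by (simp add: shift_def)

lemma finite_int_bounded:
  fixes K :: "int set"
  assumes "finite K"
  obtains c where "0 \<le> c" "K \<subseteq> {-c..c}"
proof -
  have "\<bar>k\<bar> \<le> (\<Sum>k\<in>K. \<bar>k\<bar>)" if "k \<in> K" for k
    using assms that by (intro member_le_sum) auto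
  then show thesis by (intro that[of "\<Sum>k\<in>K. \<bar>k\<bar>"]) (fastforce intro: sum_nonneg)+
qed

lemma mixing_if_contractible:
  fixes A :: "'a set" and X :: "(int \<Rightarrow> 'a) set"
  assumes A: "finite A" and X: "subshift A X" and contr: "contractible_subshift A X"
  shows "topologically_mixing X"
proof -
  have closed: "closedin (full_shift A) X" and shiftX: "\<And>g x. x \<in> X \<Longrightarrow> shift g x \<in> X"
    using X by (auto simp: subshift_def)
  have topX: "topspace (subshift_topology A X) = X"
    by (rule topspace_subshift_topology[OF closedin_subset[OF closed]])
  let ?S = "homotopy_domain {0, 1::nat} A X"
  obtain h :: "(int \<Rightarrow> nat) \<times> (int \<Rightarrow> 'a) \<times> (int \<Rightarrow> 'a) \<Rightarrow> int \<Rightarrow> 'a"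
    where cont: "continuous_map ?S (subshift_topology A X) h"
    and equiv: "\<And>g p. p \<in> topspace ?S \<Longrightarrow>
      h (map_prod (shift g) (map_prod (shift g) (shift g)) p) = shift g (h p)"
    and ends: "\<And>x y. x \<in> X \<Longrightarrow> y \<in> X \<Longrightarrow> h (\<lambda>_. 0, x, y) = x \<and> h (\<lambda>_. 1, x, y) = y"
    using contr unfolding contractible_subshift_def block_map_def by blast
  \<comment> \<open>A window for coordinate 0 is enough, since equivariance carries it to every
    other coordinate.\<close>
  have "continuous_map ?S (discrete_topology A) (\<lambda>p. h p 0)"
    using continuous_map_compose[OF cont[unfolded subshift_topology_def]
        continuous_map_from_subtopology[OF continuous_map_full_shift_eval[of A 0]]]
    by (simp add: o_def subshift_topology_def)
  then obtain K where K: "finite K" "\<And>p q. p \<in> topspace ?S \<Longrightarrow> q \<in> topspace ?S \<Longrightarrow>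
      agree_on K q p \<Longrightarrow> h q 0 = h p 0"
    using local_if_continuous_map_discrete[OF A _ closed, of "{0,1}" A] by blast
  obtain c where c: "0 \<le> c" "K \<subseteq> {-c..c}" using finite_int_bounded[OF K(1)] .
  have S: "(i, x, y) \<in> topspace ?S" if "\<forall>k. i k \<in> {0,1}" "x \<in> X" "y \<in> X" for i x y
    using that by (auto simp: topX topspace_full_shift)
  \<comment> \<open>Where the selector is constantly \<open>b\<close> within distance
    \<open>c\<close>, \<open>h\<close> cannot tell it from a constant selector, for which
    \<open>ends\<close> gives the value.\<close>
  have loc: "h (i, x, y) j = h (\<lambda>_. b, x, y) j"
    if "\<forall>k. i k \<in> {0,1}" "b \<in> {0,1}" "x \<in> X" "y \<in> X" "\<And>k. \<bar>k - j\<bar> \<le> c \<Longrightarrow> i k = b"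
    for i b x y and j :: int
  proof -
    have "h (shift (-j) i, shift (-j) x, shift (-j) y) 0
        = h (shift (-j) (\<lambda>_. b), shift (-j) x, shift (-j) y) 0"
    proof (rule K(2))
      show "agree_on K (shift (- j) i, shift (- j) x, shift (- j) y)
          (shift (- j) (\<lambda>_. b), shift (- j) x, shift (- j) y)"
        using c(2) by (fastforce simp: agree_on_def shift_int intro!: that(5))
    next
      have "\<forall>k. shift (-j) i k \<in> {0, 1}" "\<forall>k. shift (-j) (\<lambda>_. b) k \<in> {0, 1}"
        using that(1,2) unfolding shift_int by blast+
      then show "(shift (-j) i, shift (-j) x, shift (-j) y) \<in> topspace ?S"
        "(shift (-j) (\<lambda>_. b), shift (-j) x, shift (-j) y) \<in> topspace ?S"
        using that(3,4) by (blast intro: S shiftX)+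
    qed
    moreover have "h (shift (-j) i', shift (-j) x, shift (-j) y) 0 = h (i', x, y) j"
      if "\<forall>k. i' k \<in> {0,1}" for i'
      using equiv[OF S, of i' x y "-j"] that \<open>x \<in> X\<close> \<open>y \<in> X\<close> by (simp add: shift_int)
    ultimately show ?thesis using that by auto
  qed
  show ?thesis
    unfolding topologically_mixing_def
  \<comment> \<open>At this distance no point is within \<open>c\<close> both of \<open>E\<close>
    and of \<open>a + F\<close>, so one selector can be 0 near \<open>E\<close> and 1 near
    \<open>a + F\<close>.\<close>
  proof (intro allI impI exI[of _ "2 * c + 1"] ballI)
    fix E F :: "int set" and x y and a :: int
    assume xy: "x \<in> X" "y \<in> X" and far: "\<forall>e\<in>E. \<forall>f\<in>F. 2 * c + 1 \<le> \<bar>e - (a + f)\<bar>"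
    define i :: "int \<Rightarrow> nat" where "i k = (if \<exists>e\<in>E. \<bar>k - e\<bar> \<le> c then 0 else 1)" for k
    have i: "\<forall>k. i k \<in> {0,1}" by (simp add: i_def)
    show "\<exists>z\<in>X. (\<forall>e\<in>E. z e = x e) \<and> (\<forall>f\<in>F. z (a + f) = y (a + f))"
    proof (intro bexI conjI ballI)
      show "h (i, x, y) \<in> X"
        using cont S[OF i xy] by (auto simp: continuous_map_def topX)
      fix e assume "e \<in> E"
      then have "i k = 0" if "\<bar>k - e\<bar> \<le> c" for k using that by (auto simp: i_def)
      then show "h (i, x, y) e = x e"
        using loc[OF i, of 0 x y e] xy ends by auto
    next
      fix f assume f: "f \<in> F"
      have "i k = 1" if k: "\<bar>k - (a + f)\<bar> \<le> c" for k
      proof -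
        have "\<not> \<bar>k - e\<bar> \<le> c" if "e \<in> E" for e using far[rule_format, OF that f] k by linarith
        then show ?thesis by (auto simp: i_def)
      qed
      then show "h (i, x, y) (a + f) = y (a + f)"
        using loc[OF i, of 1 x y "a + f"] xy ends by auto
    qed
  qed
qed

section \<open>Mixing subshifts of finite type are contractible\<close>

text \<open>
  Morphological opening: only runs of length at least L survive. Smoothing removes short runs of
  True and then fills short runs of False.
\<close>

definition opened :: "int \<Rightarrow> (int \<Rightarrow> bool) \<Rightarrow> int \<Rightarrow> bool" where
  "opened L P j \<longleftrightarrow> (\<exists>s. s \<le> j \<and> j < s + L \<and> (\<forall>k. s \<le> k \<and> k < s + L \<longrightarrow> P k))"

definition smooth :: "int \<Rightarrow> (int \<Rightarrow> bool) \<Rightarrow> int \<Rightarrow> bool" where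
  "smooth L P j \<longleftrightarrow> \<not> opened L (\<lambda>k. \<not> opened L P k) j"

definition jump :: "(int \<Rightarrow> bool) \<Rightarrow> int \<Rightarrow> bool" where
  "jump w t \<longleftrightarrow> w (t - 1) \<noteq> w t"

section \<open>Locality and run lengths of smoothing\<close>

lemma opened_shift: "opened L (\<lambda>k. P (k - g)) j = opened L P (j - g)"
proof
  assume "opened L (\<lambda>k. P (k - g)) j"
  then obtain s where s: "s \<le> j" "j < s + L" "\<forall>k. s \<le> k \<and> k < s + L \<longrightarrow> P (k - g)"
    by (auto simp: opened_def)
  have "P k" if "s - g \<le> k \<and> k < s - g + L" for k
    using s(3)[rule_format, of "k + g"] that by simp
  then show "opened L P (j - g)"
    using s unfolding opened_def by (intro exI[of _ "s - g"]) auto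
next
  assume "opened L P (j - g)"
  then obtain s where s: "s \<le> j - g" "j - g < s + L" "\<forall>k. s \<le> k \<and> k < s + L \<longrightarrow> P k"
    by (auto simp: opened_def)
  then show "opened L (\<lambda>k. P (k - g)) j"
    unfolding opened_def by (intro exI[of _ "s + g"]) auto
qed

lemma smooth_shift: "smooth L (\<lambda>k. P (k - g)) j = smooth L P (j - g)"
  by (simp add: smooth_def opened_shift opened_shift[where P="\<lambda>k. \<not> opened L P k"])

lemma opened_cong:
  assumes "\<And>k. \<bar>k - j\<bar> \<le> L \<Longrightarrow> P k = Q k"
  shows "opened L P j = opened L Q j"
  unfolding opened_def
proof (intro ex_cong1 conj_cong refl all_cong1 imp_cong)
  fix s k assume "s \<le> j" "j < s + L" "s \<le> k \<and> k < s + L"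
  then show "P k = Q k" by (intro assms) linarith
qed

text \<open>Each opening looks at most \<open>L\<close> positions away, and smoothing performs two
  of them in succession.\<close>

lemma smooth_cong:
  assumes "\<And>k. \<bar>k - j\<bar> \<le> 2 * L \<Longrightarrow> P k = Q k"
  shows "smooth L P j = smooth L Q j"
proof -
  have "opened L P k = opened L Q k" if "\<bar>k - j\<bar> \<le> L" for k
    by (rule opened_cong, rule assms) (use that in linarith)
  then show ?thesis unfolding smooth_def by (auto cong: opened_cong)
qed

lemma smooth_const: "0 < L \<Longrightarrow> smooth L (\<lambda>_. b) j = b"
  by (cases b) (auto simp: smooth_def opened_def intro: exI[of _ j])

text \<open>After a jump to False, \<open>t\<close> lies in a run of \<open>L\<close> unopened
  positions on which smoothing is False; it cannot contain \<open>t - 1\<close>, so it starts at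
  \<open>t\<close>. After a jump to True, \<open>t\<close> is opened and \<open>t - 1\<close> is
  not, so a run of \<open>L\<close> positions satisfying \<open>P\<close> starts at
  \<open>t\<close>; these are all opened, and opened positions survive smoothing.\<close>

lemma smooth_run:
  assumes "jump (smooth L P) t" "t \<le> k" "k < t + L"
  shows "smooth L P k = smooth L P t"
proof (cases "smooth L P t")
  case False
  then obtain s where s: "s \<le> t" "t < s + L" "\<forall>k. s \<le> k \<and> k < s + L \<longrightarrow> \<not> opened L P k"
    by (auto simp: smooth_def opened_def[of L "\<lambda>k. \<not> opened L P k"])
  have low: "\<not> smooth L P k" if "s \<le> k" "k < s + L" for k
    using s that by (auto simp: smooth_def opened_def[of L "\<lambda>k. \<not> opened L P k"])
  have "smooth L P (t - 1)" using assms(1) False by (simp add: jump_def)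
  then have "s = t" using low[of "t - 1"] s(1,2) by force
  then show ?thesis using False low assms(2,3) by blast
next
  case True
  then have "\<not> smooth L P (t - 1)" using assms(1) by (simp add: jump_def)
  then obtain s where s: "s \<le> t - 1" "t - 1 < s + L"
      "\<forall>k. s \<le> k \<and> k < s + L \<longrightarrow> \<not> opened L P k"
    by (auto simp: smooth_def opened_def[of L "\<lambda>k. \<not> opened L P k"])
  have "\<not> t < s + L"
  proof
    assume "t < s + L"
    with s True show False
      by (auto simp: smooth_def opened_def[of L "\<lambda>k. \<not> opened L P k"])
  qed
  with s have sL: "s + L = t" by linarith
  have t: "opened L P t"
  proof (rule ccontr)
    assume neg: "\<not> opened L P t"
    \<comment> \<open>The unopened run ending at \<open>t - 1\<close>, moved right by one position,
      would be an unopened run containing \<open>t\<close>.\<close>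
    have "\<not> opened L P k" if "t - L + 1 \<le> k" "k < t - L + 1 + L" for k
      using that neg s(3) sL by (cases "k = t") auto
    then have "\<not> smooth L P t" using s sL assms(2,3)
      by (auto simp: smooth_def opened_def[of L "\<lambda>k. \<not> opened L P k"] intro!: exI[of _ "t - L + 1"])
    then show False using True by blast
  qed
  then obtain r where r: "r \<le> t" "t < r + L" "\<forall>k. r \<le> k \<and> k < r + L \<longrightarrow> P k"
    by (auto simp: opened_def)
  have "\<not> opened L P (t - 1)" using s by auto
  then have "r = t" using r by (force simp: opened_def)
  then have "opened L P k" using r assms(2,3) by (auto simp: opened_def)
  then show ?thesis using True
    by (auto simp: smooth_def opened_def[of L "\<lambda>k. \<not> opened L P k"])
qed

lemma smooth_jumps_far:
  assumes "jump (smooth L P) t" "jump (smooth L P) t'" "t < t'"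
  shows "t + L \<le> t'"
proof (rule ccontr)
  assume "\<not> t + L \<le> t'"
  then have "smooth L P (t' - 1) = smooth L P t" "smooth L P t' = smooth L P t"
    using assms(3) by (auto intro!: smooth_run[OF assms(1)])
  then show False using assms(2) by (simp add: jump_def)
qed

section \<open>Gluing two points at the jumps of a selector\<close>

lemma const_if_no_jump:
  assumes "a \<le> b" "\<And>t. a < t \<Longrightarrow> t \<le> b \<Longrightarrow> \<not> jump w t"
  shows "w b = w a"
  using assms
proof (induction b rule: int_ge_induct)
  case (step i)
  then have "w i = w a" "\<not> jump w (i + 1)" by auto
  then show ?case by (simp add: jump_def)
qed simp

text \<open>The choice depends on \<open>u\<close> and \<open>v\<close> only through one word of
  length \<open>n\<close> each, so it amounts to a fixed table of connecting words and can be part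
  of a local rule.\<close>

definition bridge :: "(int \<Rightarrow> 'a) set \<Rightarrow> int \<Rightarrow> int \<Rightarrow> (int \<Rightarrow> 'a) \<Rightarrow> (int \<Rightarrow> 'a) \<Rightarrow> int \<Rightarrow> 'a" where
  "bridge X n m u v = (SOME z. z \<in> X \<and> (\<forall>k\<in>{-n..<0}. z k = u k) \<and> (\<forall>k\<in>{m..<m+n}. z k = v k))"

text \<open>The selector is read at one position \<open>t\<close>, but the result is a whole
  configuration. Thus the words on either side of a jump are taken from points of the
  subshift.\<close>

definition source :: "(int \<Rightarrow> bool) \<Rightarrow> (int \<Rightarrow> 'a) \<Rightarrow> (int \<Rightarrow> 'a) \<Rightarrow> int \<Rightarrow> int \<Rightarrow> 'a" where
  "source w x y t = (if w t then y else x)"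

text \<open>
  The configuration is glued by a rule that reads its arguments relative to the current position,
  which makes it shift-commuting by construction.
\<close>

definition glue_at_zero ::
  "(int \<Rightarrow> 'a) set \<Rightarrow> int \<Rightarrow> int \<Rightarrow> (int \<Rightarrow> bool) \<Rightarrow> (int \<Rightarrow> 'a) \<Rightarrow> (int \<Rightarrow> 'a) \<Rightarrow> 'a" where
  "glue_at_zero X n m w x y =
    (if \<exists>t. -m < t \<and> t \<le> 0 \<and> jump w t
     then let t = (SOME t. -m < t \<and> t \<le> 0 \<and> jump w t) in
       bridge X n m (\<lambda>k. source w x y (t - 1) (t + k)) (\<lambda>k. source w x y t (t + k)) (- t)
     else source w x y 0 0)"

definition glue ::
  "(int \<Rightarrow> 'a) set \<Rightarrow> int \<Rightarrow> int \<Rightarrow> (int \<Rightarrow> bool) \<Rightarrow> (int \<Rightarrow> 'a) \<Rightarrow> (int \<Rightarrow> 'a) \<Rightarrow> int \<Rightarrow> 'a" where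
  "glue X n m w x y j =
     glue_at_zero X n m (\<lambda>k. w (j + k)) (\<lambda>k. x (j + k)) (\<lambda>k. y (j + k))"

lemma bridge_cong:
  assumes "\<And>k. -n \<le> k \<Longrightarrow> k < 0 \<Longrightarrow> u k = u' k" "\<And>k. m \<le> k \<Longrightarrow> k < m + n \<Longrightarrow> v k = v' k"
  shows "bridge X n m u v = bridge X n m u' v'"
proof -
  have "(\<forall>k\<in>{-n..<0}. z k = u k) = (\<forall>k\<in>{-n..<0}. z k = u' k)"
    "(\<forall>k\<in>{m..<m+n}. z k = v k) = (\<forall>k\<in>{m..<m+n}. z k = v' k)" for z
    using assms by auto
  then show ?thesis by (simp add: bridge_def)
qed

lemma bridge:
  assumes "\<exists>z\<in>X. (\<forall>k\<in>{-n..<0}. z k = u k) \<and> (\<forall>k\<in>{m..<m+n}. z k = v k)"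
  shows "bridge X n m u v \<in> X" "\<And>k. -n \<le> k \<Longrightarrow> k < 0 \<Longrightarrow> bridge X n m u v k = u k"
    "\<And>k. m \<le> k \<Longrightarrow> k < m + n \<Longrightarrow> bridge X n m u v k = v k"
  using someI_ex[OF assms[unfolded Bex_def]] by (auto simp: bridge_def)

text \<open>The jump used lies in \<open>{-m<..0}\<close> and the selector is read only there, one
  position to its left, and at 0. The two words extend from it \<open>n\<close> to the left and
  \<open>m + n\<close> to the right, hence within \<open>m + n\<close> of 0.\<close>

lemma glue_at_zero_cong:
  assumes w: "\<And>k. \<bar>k\<bar> \<le> m + 1 \<Longrightarrow> w k = w' k" and "0 < n" "0 < m"
    and xy: "\<And>k. \<bar>k\<bar> \<le> m + n \<Longrightarrow> x k = x' k" "\<And>k. \<bar>k\<bar> \<le> m + n \<Longrightarrow> y k = y' k"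
  shows "glue_at_zero X n m w x y = glue_at_zero X n m w' x' y'"
proof -
  \<comment> \<open>Both selectors have the same candidate jumps, so \<open>SOME\<close> picks the
    same one for both.\<close>
  have jump: "(-m < t \<and> t \<le> 0 \<and> jump w t) = (-m < t \<and> t \<le> 0 \<and> jump w' t)" for t
    using w[of "t - 1"] w[of t] by (auto simp: jump_def)
  have 0: "source w x y 0 0 = source w' x' y' 0 0"
    using w[of 0] xy[of 0] assms(2,3) by (simp add: source_def)
  have "bridge X n m (\<lambda>k. source w x y (t - 1) (t + k)) (\<lambda>k. source w x y t (t + k))
     = bridge X n m (\<lambda>k. source w' x' y' (t - 1) (t + k)) (\<lambda>k. source w' x' y' t (t + k))"
    if "-m < t \<and> t \<le> 0 \<and> jump w' t" for t
    using w[of "t - 1"] w[of t] that assms(2,3)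
    by (intro bridge_cong) (auto simp: source_def intro!: xy)
  moreover have "-m < (SOME t. Q t) \<and> (SOME t. Q t) \<le> 0 \<and> jump w' (SOME t. Q t)"
    if "\<exists>t. -m < t \<and> t \<le> 0 \<and> jump w' t" "Q = (\<lambda>t. -m < t \<and> t \<le> 0 \<and> jump w' t)" for Q
    using someI_ex[OF that(1)] that(2) by simp
  ultimately show ?thesis
    unfolding glue_at_zero_def jump using 0 by (auto simp: Let_def)
qed

text \<open>\<open>uniq\<close> makes the choice in \<open>glue_at_zero\<close> definite. It holds
  for smoothed selectors with \<open>m <= L\<close>, since two jumps within \<open>m\<close>
  positions ending at \<open>j\<close> would be less than \<open>L\<close> apart.\<close>

lemma glue_at_jump:
  assumes "jump w t" "t \<le> j" "j < t + m"
    and uniq: "\<And>t'. t' \<le> j \<Longrightarrow> j < t' + m \<Longrightarrow> jump w t' \<Longrightarrow> t' = t"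
  shows "glue X n m w x y j =
    bridge X n m (\<lambda>k. source w x y (t - 1) (t + k)) (\<lambda>k. source w x y t (t + k)) (j - t)"
proof -
  let ?w = "\<lambda>k. w (j + k)"
  have J: "jump ?w s = jump w (j + s)" for s by (simp add: jump_def algebra_simps)
  have ex: "-m < t - j \<and> t - j \<le> 0 \<and> jump ?w (t - j)" using assms(1-3) by (simp add: J)
  have "s = t - j" if "-m < s \<and> s \<le> 0 \<and> jump ?w s" for s
    using uniq[of "j + s"] that by (simp add: J)
  then have "(SOME s. -m < s \<and> s \<le> 0 \<and> jump ?w s) = t - j"
    using ex by (intro some_equality) blast+
  then show ?thesis
    using ex by (auto simp: glue_def glue_at_zero_def source_def Let_def algebra_simps)
qed

lemma glue_off_jump:
  assumes "\<And>t. t \<le> j \<Longrightarrow> j < t + m \<Longrightarrow> \<not> jump w t"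
  shows "glue X n m w x y j = source w x y j j"
proof -
  have "\<not> jump (\<lambda>k. w (j + k)) s" if "-m < s" "s \<le> 0" for s
    using assms[of "j + s"] that by (simp add: jump_def algebra_simps)
  then show ?thesis by (auto simp: glue_def glue_at_zero_def source_def)
qed

lemma glue_shift:
  "glue X n m (\<lambda>k. w (k - g)) (\<lambda>k. x (k - g)) (\<lambda>k. y (k - g)) j = glue X n m w x y (j - g)"
  by (simp add: glue_def algebra_simps)

text \<open>Take \<open>c\<close> bounding the domains of all forbidden patterns. A pattern
  appearing in \<open>z\<close> at \<open>g\<close> would also appear in the point of
  \<open>X\<close> that matches \<open>z\<close> around \<open>g\<close>. Membership of a glued
  configuration can therefore be checked window by window.\<close>

lemma sft_local:
  fixes X :: "(int \<Rightarrow> 'a) set"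
  assumes "sft A X"
  shows "\<exists>c\<ge>0. \<forall>z. (\<forall>g. \<exists>x\<in>X. \<forall>k. \<bar>k - g\<bar> \<le> c \<longrightarrow> z k = x k) \<longrightarrow> z \<in> X"
proof -
  obtain P where P: "finite P" "\<forall>p\<in>P. finite_pattern A p"
    and X: "X = {x \<in> topspace (full_shift A). \<forall>p\<in>P. \<not> appears_in p x}"
    using assms unfolding sft_def by blast
  have "finite (\<Union> (dom ` P))" using P by (auto simp: finite_pattern_def)
  then obtain c where c: "0 \<le> c" "\<Union> (dom ` P) \<subseteq> {-c..c}" by (rule finite_int_bounded)
  show ?thesis
  proof (intro exI[of _ c] conjI allI impI)
    fix z assume z: "\<forall>g. \<exists>x\<in>X. \<forall>k. \<bar>k - g\<bar> \<le> c \<longrightarrow> z k = x k"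
    have "z g \<in> A" for g
    proof -
      obtain x where "x \<in> X" "z g = x g" using z[rule_format, of g] c(1) by auto
      then show ?thesis by (simp add: X topspace_full_shift)
    qed
    moreover have "\<not> appears_in p z" if "p \<in> P" for p
    proof
      assume "appears_in p z"
      then obtain g where g: "\<forall>d\<in>dom p. p d = Some (z (g + d))" by (auto simp: appears_in_def)
      obtain x where x: "x \<in> X" "\<forall>k. \<bar>k - g\<bar> \<le> c \<longrightarrow> z k = x k" using z by blast
      have "z (g + d) = x (g + d)" if "d \<in> dom p" for d
        using x(2) c(2) \<open>p \<in> P\<close> that by (force simp: abs_le_iff)
      then have "appears_in p x" using g by (auto simp: appears_in_def)
      then show False using x(1) \<open>p \<in> P\<close> by (simp add: X)
    qed
    ultimately show "z \<in> X" by (simp add: X topspace_full_shift)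
  qed (rule c(1))
qed

text \<open>Other jumps are at least \<open>m + n\<close> away: an earlier connecting word ends
  before \<open>t - n\<close>, and a later one starts no sooner than \<open>t + m + n\<close>. Up to
  \<open>t\<close> and from \<open>t + m\<close> on the glued configuration copies its sources, and
  these are exactly the words joined by the bridge at \<open>t\<close>, so one translated bridge
  matches the whole stretch.\<close>

lemma glue_smooth_near_jump:
  assumes t: "jump (smooth L P) t" and L: "m + n \<le> L" and "0 < n" "0 < m"
    and ex: "\<And>u v. u \<in> X \<Longrightarrow> v \<in> X \<Longrightarrow>
      \<exists>z\<in>X. (\<forall>k\<in>{-n..<0}. z k = u k) \<and> (\<forall>k\<in>{m..<m+n}. z k = v k)"
    and shiftX: "\<And>g x. x \<in> X \<Longrightarrow> (\<lambda>k. x (g + k)) \<in> X"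
    and xy: "x \<in> X" "y \<in> X"
  shows "\<exists>b\<in>X. \<forall>k. t - n \<le> k \<and> k < t + m + n \<longrightarrow> glue X n m (smooth L P) x y k = b k"
proof -
  let ?w = "smooth L P"
  let ?u = "\<lambda>k. source ?w x y (t - 1) (t + k)" and ?v = "\<lambda>k. source ?w x y t (t + k)"
  let ?b = "bridge X n m ?u ?v"
  have far: "t' = t \<or> t' + L \<le> t \<or> t + L \<le> t'" if "jump ?w t'" for t'
    using smooth_jumps_far[OF t that] smooth_jumps_far[OF that t] by linarith
  have "?u \<in> X" "?v \<in> X" using shiftX xy by (auto simp: source_def)
  note b = bridge[OF ex[OF this]]
  have "glue X n m ?w x y k = ?b (k - t)" if k: "t - n \<le> k" "k < t + m + n" for k
  proof -
    consider "k < t" | "t \<le> k" "k < t + m" | "t + m \<le> k" by linarith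
    then show ?thesis
    proof cases
      case 1
      have "?w (t - 1) = ?w k"
        by (rule const_if_no_jump) (use far 1 k L assms(3,4) in force)+
      moreover have "glue X n m ?w x y k = source ?w x y k k"
        by (rule glue_off_jump) (use far 1 k L assms(3,4) in force)
      ultimately show ?thesis using b(2)[of "k - t"] 1 k by (simp add: source_def)
    next
      case 2
      then show ?thesis
        by (intro glue_at_jump[OF t]) (use far L assms(3,4) in force)+
    next
      case 3
      have "?w k = ?w t" by (rule smooth_run[OF t]) (use 3 k L assms(3,4) in linarith)+
      moreover have "glue X n m ?w x y k = source ?w x y k k"
        by (rule glue_off_jump) (use far 3 k L assms(3,4) in force)
      ultimately show ?thesis using b(3)[of "k - t"] 3 k by (simp add: source_def)
    qed
  qed
  moreover have "(\<lambda>k. ?b (- t + k)) \<in> X" by (rule shiftX[OF b(1)])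
  ultimately show ?thesis by (intro bexI[of _ "\<lambda>k. ?b (- t + k)"]) auto
qed

section \<open>The contraction obtained by gluing along the smoothed selector\<close>

lemma contractible_if_mixing:
  fixes A :: "'a set" and X :: "(int \<Rightarrow> 'a) set"
  assumes sft: "sft A X" and mix: "topologically_mixing X"
  shows "contractible_subshift A X"
proof -
  have closed: "closedin (full_shift A) X" and shiftX: "\<And>g x. x \<in> X \<Longrightarrow> shift g x \<in> X"
    using sft unfolding subshift_def sft_def by blast+
  have shiftX': "(\<lambda>k. x (g + k)) \<in> X" if "x \<in> X" for x g
    using shiftX[OF that, of "-g"] by (simp add: shift_def)
  have topX: "topspace (subshift_topology A X) = X"
    by (rule topspace_subshift_topology[OF closedin_subset[OF closed]])
  obtain c where c: "0 \<le> c"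
    and local: "\<forall>z. (\<forall>g. \<exists>x\<in>X. \<forall>k. \<bar>k - g\<bar> \<le> c \<longrightarrow> z k = x k) \<longrightarrow> z \<in> X"
    using sft_local[OF sft] by (elim exE conjE)
  \<comment> \<open>A window of radius \<open>c\<close> has \<open>2 * c + 1\<close> positions, so
    if it meets \<open>{t..<t+m}\<close> it stays inside \<open>{t-n..<t+m+n}\<close>.\<close>
  define n where "n = 2 * c + 1"
  have fin: "finite {-n..<0} \<and> finite {0..<n}" by simp
  obtain R :: int where R: "\<forall>x\<in>X. \<forall>y\<in>X. \<forall>a. (\<forall>e\<in>{-n..<0}. \<forall>f\<in>{0..<n}. R \<le> \<bar>e - (a + f)\<bar>) \<longrightarrow>
      (\<exists>z\<in>X. (\<forall>e\<in>{-n..<0}. z e = x e) \<and> (\<forall>f\<in>{0..<n}. z (a + f) = y (a + f)))"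
    using mix[unfolded topologically_mixing_def, THEN spec, THEN spec, THEN mp, OF fin] ..
  \<comment> \<open>With \<open>a = m\<close> the two words are separated by at least
    \<open>R\<close>; the maximum with 1 keeps \<open>m\<close> positive when \<open>R\<close> is
    not.\<close>
  define m where "m = max R 1"
  have pos: "0 < n" "0 < m" using c by (auto simp: n_def m_def)
  have ex: "\<exists>z\<in>X. (\<forall>k\<in>{-n..<0}. z k = u k) \<and> (\<forall>k\<in>{m..<m+n}. z k = v k)"
    if uv: "u \<in> X" "v \<in> X" for u v
  proof -
    have far: "\<forall>e\<in>{-n..<0}. \<forall>f\<in>{0..<n}. R \<le> \<bar>e - (m + f)\<bar>" by (auto simp: m_def)
    obtain z where z: "z \<in> X" "\<forall>e\<in>{-n..<0}. z e = u e" "\<forall>f\<in>{0..<n}. z (m + f) = v (m + f)"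
      using R[THEN bspec, OF uv(1), THEN bspec, OF uv(2), THEN spec, THEN mp, OF far]
      by (elim bexE conjE)
    have "z k = v k" if "k \<in> {m..<m+n}" for k using z(3)[rule_format, of "k - m"] that by auto
    then show ?thesis using z by blast
  qed
  define L where "L = m + n"
  have L: "0 < L" using pos by (simp add: L_def)
  \<comment> \<open>Every selector value other than 1 counts as 0, so \<open>h\<close> is meaningful
    for arbitrary \<open>i\<close>.\<close>
  define w where "w i = smooth L (\<lambda>k. i k = (1::nat))" for i
  define h where "h = (\<lambda>(i, x, y). glue X n m (w i) x y)"
  have hX: "h (i, x, y) \<in> X" if xy: "x \<in> X" "y \<in> X" for i x y
  proof (rule local[rule_format])
    fix g
    show "\<exists>b\<in>X. \<forall>k. \<bar>k - g\<bar> \<le> c \<longrightarrow> h (i, x, y) k = b k"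
    \<comment> \<open>The cases are whether or not some connecting word, placed on
      \<open>{t..<t+m}\<close>, meets the window. If none does, the smoothed selector is constant
      there and \<open>x\<close> or \<open>y\<close> itself matches.\<close>
    proof (cases "\<exists>t. jump (w i) t \<and> t \<le> g + c \<and> g - c < t + m")
      case True
      then obtain t where t: "jump (w i) t" "t \<le> g + c" "g - c < t + m" by blast
      have "\<exists>b\<in>X. \<forall>k. t - n \<le> k \<and> k < t + m + n \<longrightarrow> h (i, x, y) k = b k"
        unfolding h_def prod.case w_def
        by (rule glue_smooth_near_jump[OF t(1)[unfolded w_def]])
          (simp add: L_def, fact pos, fact pos, erule (1) ex, erule shiftX', fact xy, fact xy)
      moreover have "t - n \<le> k \<and> k < t + m + n" if "\<bar>k - g\<bar> \<le> c" for k
        using t(2,3) that unfolding n_def by linarith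
      ultimately show ?thesis by blast
    next
      case False
      have const: "w i k = w i (g - c)" if "\<bar>k - g\<bar> \<le> c" for k
      proof (rule const_if_no_jump)
        fix s assume "g - c < s" "s \<le> k"
        then have "s \<le> g + c" "g - c < s + m" using that pos by linarith+
        then show "\<not> jump (w i) s" using False by blast
      qed (use that in linarith)
      have "h (i, x, y) k = source (w i) x y k k" if "\<bar>k - g\<bar> \<le> c" for k
        unfolding h_def prod.case
      proof (rule glue_off_jump)
        fix s assume "s \<le> k" "k < s + m"
        then have "s \<le> g + c" "g - c < s + m" using that by linarith+
        then show "\<not> jump (w i) s" using False by blast
      qed
      then have "\<forall>k. \<bar>k - g\<bar> \<le> c \<longrightarrow> h (i, x, y) k = source (w i) x y (g - c) k"
        unfolding source_def using const by metis
      moreover have "source (w i) x y (g - c) \<in> X" using xy by (simp add: source_def)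
      ultimately show ?thesis by blast
    qed
  qed
  let ?S = "homotopy_domain {0, 1::nat} A X"
  have hS: "h p \<in> X" if "p \<in> topspace ?S" for p
    using that hX by (cases p) (auto simp: topX)
  have XA: "x k \<in> A" if "x \<in> X" for x k
    using that closedin_subset[OF closed] by (auto simp: topspace_full_shift)
  \<comment> \<open>Gluing reads the smoothed selector up to \<open>m + 1 <= L + 1\<close> away and
    smoothing adds \<open>2 * L\<close>; the points \<open>x\<close> and \<open>y\<close> are read
    only up to \<open>L\<close> away.\<close>
  have "h q j = h p j" if "agree_on {j - (3 * L + 1)..j + (3 * L + 1)} q p" for p q j
  proof -
    obtain i x y i' x' y' where pq: "p = (i, x, y)" "q = (i', x', y')" by (metis prod.exhaust)
    have agree: "i' k = i k" "x' k = x k" "y' k = y k" if "\<bar>k - j\<bar> \<le> 3 * L + 1" for k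
      using \<open>agree_on _ q p\<close> that by (auto simp: agree_on_def pq abs_le_iff)
    have "w i' (j + k) = w i (j + k)" if "\<bar>k\<bar> \<le> m + 1" for k
      unfolding w_def
    proof (rule smooth_cong)
      fix l assume "\<bar>l - (j + k)\<bar> \<le> 2 * L"
      then have "\<bar>l - j\<bar> \<le> 3 * L + 1" using that pos by (simp add: L_def)
      then show "(i' l = 1) = (i l = 1)" by (simp add: agree)
    qed
    then show ?thesis
      unfolding h_def pq prod.case glue_def
      by (intro glue_at_zero_cong pos agree) (use L in \<open>auto simp: L_def\<close>)
  qed
  then have "continuous_map ?S (discrete_topology A) (\<lambda>p. h p j)" for j
    using hS XA
    by (intro continuous_map_discrete_if_local[where K="{j - (3 * L + 1)..j + (3 * L + 1)}"]) auto
  then have cont: "continuous_map ?S (subshift_topology A X) h"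
    using hS unfolding subshift_topology_def full_shift_def
    by (auto simp: continuous_map_in_subtopology continuous_map_componentwise_UNIV)
  have "h (shift g i, shift g x, shift g y) = shift g (h (i, x, y))" for g i x y
  proof -
    have "w (shift g i) = (\<lambda>k. w i (k - g))"
      unfolding w_def shift_int by (rule ext) (rule smooth_shift)
    then show ?thesis
      unfolding h_def prod.case shift_int by (intro ext) (simp only: glue_shift)
  qed
  then have "block_map ?S (\<lambda>g. map_prod (shift g) (map_prod (shift g) (shift g)))
      (subshift_topology A X) shift h"
    unfolding block_map_def using cont by (simp add: map_prod_def split: prod.split)
  \<comment> \<open>Smoothing fixes constant selectors, so there are no jumps and one argument is
    copied everywhere.\<close>
  moreover have "h (\<lambda>_. 0, x, y) = x" "h (\<lambda>_. 1, x, y) = y" for x y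
  proof -
    have "h (\<lambda>_. b, x, y) k = source (w (\<lambda>_. b)) x y k k" for b k
      unfolding h_def prod.case w_def
      by (rule glue_off_jump) (simp add: jump_def smooth_const[OF L])
    then show "h (\<lambda>_. 0, x, y) = x" "h (\<lambda>_. 1, x, y) = y"
      by (auto simp: source_def w_def smooth_const[OF L])
  qed
  ultimately show ?thesis unfolding contractible_subshift_def by blast
qed

theorem theorem1p3:
  fixes A :: "'a set" and X :: "(int \<Rightarrow> 'a) set"
  assumes "finite A" and "sft A X"
  shows "topologically_mixing X \<longleftrightarrow> contractible_subshift A X"
proof
  show "contractible_subshift A X" if "topologically_mixing X"
    by (rule contractible_if_mixing[OF assms(2) that])
  have "subshift A X" using assms(2) unfolding sft_def by (rule conjunct1)
  then show "topologically_mixing X" if "contractible_subshift A X"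
    using mixing_if_contractible[OF assms(1) _ that] by simp
qed

end
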